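(* Let $\mu_{\mathrm C}$ be the standard middle-third Cantor measure. Then $L^2(\mu_{\mathrm C})$ admits no Fourier frame.
   Context: The standard middle-third Cantor measure $\mu_{\mathrm C}$ is the self-similar Borel probability measure on $\mathbb R$ determined by $$\mu_{\mathrm C}=\tfrac12\,\mu_{\mathrm C}\circ\tau_0^{-1}+\tfrac12\,\mu_{\mathrm C}\circ\tau_2^{-1},\qquad \tau_0(x)=\frac x3,\quad \tau_2(x)=\frac{x+2}{3}.$$ Equivalently, it is the distribution of $\sum_{j=1}^\infty \frac{2\varepsilon_j}{3^j}$, where $\varepsilon_1,\varepsilon_2,\ldots$ are independent and each is uniformly distributed on $\{0,1\}$. For a compactly supported Borel probability measure $\mu$ on $\mathbb R$, $L^2(\mu)$ is the complex Hilbert space with inner product $\langle f,g\rangle_{L^2(\mu)}=\int_{\mathbb R} f\,\overline{g}\,d\mu$, and $e_\lambda(x)=e^{2\pi i\lambda x}$ for $\lambda\in\mathbb R$. A countable set $\Lambda\subset\mathbb R$ is a Fourier frame spectrum for $\mu$ if there exist constants $0<A\le C<\infty$ such that $$A\|f\|_{L^2(\mu)}^2\le\sum_{\lambda\in\Lambda}|\langle f,e_\lambda\rangle_{L^2(\mu)}|^2\le C\|f\|_{L^2(\mu)}^2\quad\text{for all } f\in L^2(\mu).$$ $L^2(\mu)$ admits a Fourier frame if some Fourier frame spectrum for $\mu$ exists. *)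

theory Defs
  imports "HOL-Probability.Probability"
begin

section \<open>The middle-third Cantor measure\<close>

definition cantor_self_similar :: "real measure \<Rightarrow> bool" where
  "cantor_self_similar M \<longleftrightarrow>
     prob_space M \<and> sets M = sets borel \<and>
     (\<forall>B \<in> sets borel. measure M B =
        1 / 2 * measure M ((\<lambda>x. x / 3) -` B) + 1 / 2 * measure M ((\<lambda>x. (x + 2) / 3) -` B))"

abbreviation fair_coin :: "bool measure" where
  "fair_coin \<equiv> measure_pmf (pmf_of_set UNIV)"

definition cantor_sum :: "(nat \<Rightarrow> bool) \<Rightarrow> real" where
  "cantor_sum \<epsilon> = (\<Sum>j. 2 * of_bool (\<epsilon> j) / 3 ^ Suc j)"

text \<open>The digits are indexed from \<open>0\<close>, whence the exponent \<open>Suc j\<close>. Lemma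
  \<open>cantor_self_similar_iff\<close> below shows that this distribution is the one and only measure
  satisfying the self-similarity equation.\<close>

definition cantor_measure :: "real measure" where
  "cantor_measure = distr (\<Pi>\<^sub>M j\<in>UNIV. fair_coin) borel cantor_sum"

lemma summable_cantor_sum: "summable (\<lambda>j. 2 * of_bool (\<epsilon> j) / 3 ^ Suc j :: real)"
proof (rule summable_comparison_test')
  show "summable (\<lambda>j. 2 / 3 * (1 / 3) ^ j :: real)"
    by (intro summable_mult summable_geometric) auto
  show "norm (2 * of_bool (\<epsilon> j) / 3 ^ Suc j :: real) \<le> 2 / 3 * (1 / 3) ^ j" if "j \<ge> 0" for j
    by (auto simp: power_divide of_bool_def)
qed

lemma cantor_sum_bounds: "cantor_sum \<epsilon> \<in> {0..1}"
proof -
  have "(\<lambda>j. 2 / 3 * (1 / 3) ^ j :: real) sums (2 / 3 * (1 / (1 - 1 / 3)))"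
    by (intro sums_mult geometric_sums) auto
  then have *: "(\<lambda>j. 2 / 3 * (1 / 3) ^ j :: real) sums 1" by simp
  have "cantor_sum \<epsilon> \<le> (\<Sum>j. 2 / 3 * (1 / 3) ^ j)"
    unfolding cantor_sum_def
    by (intro suminf_le summable_cantor_sum sums_summable[OF *]) (auto simp: power_divide of_bool_def)
  moreover have "0 \<le> cantor_sum \<epsilon>"
    unfolding cantor_sum_def by (intro suminf_nonneg summable_cantor_sum) auto
  ultimately show ?thesis using sums_unique[OF *] by simp
qed

lemma cantor_sum_case_nat:
  "cantor_sum (case_nat s \<epsilon>) = (cantor_sum \<epsilon> + 2 * of_bool s) / 3"
proof -
  have "cantor_sum (case_nat s \<epsilon>) =
      (\<Sum>j. 2 * of_bool (\<epsilon> j) / 3 ^ Suc (Suc j)) + 2 * of_bool s / 3"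
    using suminf_split_head[OF summable_cantor_sum[of "case_nat s \<epsilon>"]]
    unfolding cantor_sum_def by simp
  also have "(\<Sum>j. 2 * of_bool (\<epsilon> j) / 3 ^ Suc (Suc j)) = cantor_sum \<epsilon> / 3"
    unfolding cantor_sum_def
    by (subst suminf_divide[OF summable_cantor_sum, symmetric]) (simp add: field_simps)
  finally show ?thesis by (simp add: add_divide_distrib)
qed

lemma measurable_cantor_sum [measurable]:
  "cantor_sum \<in> borel_measurable (\<Pi>\<^sub>M j\<in>UNIV. fair_coin)"
  unfolding cantor_sum_def by measurable

lemma sets_cantor_measure [simp]: "sets cantor_measure = sets borel"
  and space_cantor_measure [simp]: "space cantor_measure = UNIV"
  by (simp_all add: cantor_measure_def)

interpretation coin_sequence: sequence_space fair_coin ..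

lemma prob_space_cantor_measure: "prob_space cantor_measure"
  unfolding cantor_measure_def by (rule coin_sequence.prob_space_distr) measurable

lemma AE_cantor_measure_unit_interval: "AE x in cantor_measure. x \<in> {0..1}"
  unfolding cantor_measure_def
  using cantor_sum_bounds by (subst AE_distr_iff) auto

definition cantor_step :: "real measure \<Rightarrow> real measure" where
  "cantor_step M = distr (fair_coin \<Otimes>\<^sub>M M) borel (\<lambda>(s, x). (x + 2 * of_bool s) / 3)"

lemma measurable_cantor_step_map:
  assumes "sets M = sets borel"
  shows "(\<lambda>(s, x). (x + 2 * of_bool s) / 3 :: real) \<in> borel_measurable (fair_coin \<Otimes>\<^sub>M M)"
proof -
  note [measurable_cong] = assms
  show ?thesis by measurable
qed

lemma cantor_step_cantor_measure: "cantor_step cantor_measure = cantor_measure"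
proof -
  let ?S = "\<Pi>\<^sub>M j\<in>(UNIV :: nat set). fair_coin"
  have "cantor_measure =
      distr (distr (fair_coin \<Otimes>\<^sub>M ?S) ?S (\<lambda>(s, \<omega>). case_nat s \<omega>)) borel cantor_sum"
    unfolding coin_sequence.PiM_iter cantor_measure_def ..
  also have "\<dots> = distr (fair_coin \<Otimes>\<^sub>M ?S) borel
      (\<lambda>(s, \<omega>). (cantor_sum \<omega> + 2 * of_bool s) / 3)"
    by (subst distr_distr) (auto intro!: distr_cong simp: cantor_sum_case_nat)
  also have "\<dots> = distr (distr (fair_coin \<Otimes>\<^sub>M ?S) (fair_coin \<Otimes>\<^sub>M borel)
      (\<lambda>(s, \<omega>). (s, cantor_sum \<omega>))) borel (\<lambda>(s, x). (x + 2 * of_bool s) / 3)"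
    by (subst distr_distr) (auto intro!: distr_cong)
  also have "distr (fair_coin \<Otimes>\<^sub>M ?S) (fair_coin \<Otimes>\<^sub>M borel) (\<lambda>(s, \<omega>). (s, cantor_sum \<omega>)) =
      distr fair_coin fair_coin (\<lambda>s. s) \<Otimes>\<^sub>M cantor_measure"
    unfolding cantor_measure_def
    by (subst pair_measure_distr)
       (auto intro!: prob_space_imp_sigma_finite coin_sequence.prob_space_distr)
  finally show ?thesis by (simp add: cantor_step_def distr_id2)
qed

lemma emeasure_cantor_step:
  assumes "prob_space M" and [measurable_cong]: "sets M = sets borel" and [measurable]: "B \<in> sets borel"
  shows "emeasure (cantor_step M) B =
    (emeasure M ((\<lambda>x. x / 3) -` B) + emeasure M ((\<lambda>x. (x + 2) / 3) -` B)) / 2"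
proof -
  interpret prob_space M by fact
  have sp: "space M = UNIV" using sets_eq_imp_space_eq[OF assms(2)] by simp
  note measurable_cantor_step_map[OF assms(2), measurable]
  let ?A = "(\<lambda>(s, x). (x + 2 * of_bool s) / 3 :: real) -` B \<inter> space (fair_coin \<Otimes>\<^sub>M M)"
  have "emeasure (cantor_step M) B = emeasure (fair_coin \<Otimes>\<^sub>M M) ?A"
    unfolding cantor_step_def by (rule emeasure_distr) measurable
  also have "\<dots> = (\<integral>\<^sup>+s. emeasure M (Pair s -` ?A) \<partial>fair_coin)"
    by (rule emeasure_pair_measure_alt) measurable
  also have "\<dots> = (\<Sum>s\<in>UNIV. emeasure M (Pair s -` ?A)) / 2"
    by (subst nn_integral_pmf_of_set) auto
  also have "\<dots> = (emeasure M ((\<lambda>x. x / 3) -` B) + emeasure M ((\<lambda>x. (x + 2) / 3) -` B)) / 2"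
    by (simp add: UNIV_bool space_pair_measure sp vimage_def add.commute)
  finally show ?thesis .
qed

lemma cantor_self_similar_iff_step:
  "cantor_self_similar M \<longleftrightarrow> prob_space M \<and> sets M = sets borel \<and> cantor_step M = M"
proof -
  {
    assume M: "prob_space M" "sets M = sets borel"
    interpret prob_space M by fact
    have "cantor_step M = M \<longleftrightarrow> (\<forall>B\<in>sets borel. emeasure (cantor_step M) B = emeasure M B)"
      using M(2) by (auto intro!: measure_eqI simp: cantor_step_def)
    also have "\<dots> \<longleftrightarrow> (\<forall>B \<in> sets borel. measure M B =
        1 / 2 * measure M ((\<lambda>x. x / 3) -` B) + 1 / 2 * measure M ((\<lambda>x. (x + 2) / 3) -` B))"
    proof (intro ball_cong refl)
      fix B :: "real set" assume "B \<in> sets borel"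
      then have *: "emeasure (cantor_step M) B =
          ennreal ((measure M ((\<lambda>x. x / 3) -` B) + measure M ((\<lambda>x. (x + 2) / 3) -` B)) / 2)"
        by (subst emeasure_cantor_step[OF M])
           (simp_all add: emeasure_eq_measure flip: ennreal_plus divide_ennreal)
      show "emeasure (cantor_step M) B = emeasure M B \<longleftrightarrow> measure M B =
        1 / 2 * measure M ((\<lambda>x. x / 3) -` B) + 1 / 2 * measure M ((\<lambda>x. (x + 2) / 3) -` B)"
        unfolding * emeasure_eq_measure
        by (subst ennreal_inj) (auto simp: add_divide_distrib)
    qed
    finally have "cantor_step M = M \<longleftrightarrow> (\<forall>B \<in> sets borel. measure M B =
        1 / 2 * measure M ((\<lambda>x. x / 3) -` B) + 1 / 2 * measure M ((\<lambda>x. (x + 2) / 3) -` B))" .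
  }
  then show ?thesis unfolding cantor_self_similar_def by blast
qed

lemma char_cantor_step:
  assumes "prob_space M" and [measurable_cong]: "sets M = sets borel"
  shows "char (cantor_step M) t = (1 + iexp (2 * t / 3)) / 2 * char M (t / 3)"
proof -
  interpret prob_space M by fact
  interpret coin: prob_space fair_coin by (rule measure_pmf.prob_space_axioms)
  interpret pair_prob_space fair_coin M ..
  note measurable_cantor_step_map[OF assms(2), measurable]
  let ?f = "\<lambda>s x. iexp (t * ((x + 2 * of_bool s) / 3))"
  have "char (cantor_step M) t = (LINT p|(fair_coin \<Otimes>\<^sub>M M). ?f (fst p) (snd p))"
    unfolding char_def cantor_step_def
    by (subst integral_distr) (simp_all add: case_prod_beta)
  also have "\<dots> = (LINT s|fair_coin. LINT x|M. ?f s x)"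
    by (subst integral_fst'[symmetric])
       (auto intro!: P.integrable_const_bound[where B = 1])
  also have "\<dots> = ((LINT x|M. ?f False x) + (LINT x|M. ?f True x)) / 2"
    by (subst integral_measure_pmf[of UNIV])
       (auto simp: UNIV_bool scaleR_conv_of_real field_simps)
  also have "(LINT x|M. ?f False x) = char M (t / 3)"
    by (simp add: char_def)
  also have "(LINT x|M. ?f True x) = (LINT x|M. iexp (2 * t / 3) * iexp (t / 3 * x))"
    by (intro Bochner_Integration.integral_cong refl)
       (simp add: algebra_simps add_divide_distrib flip: exp_add)
  also have "\<dots> = iexp (2 * t / 3) * char M (t / 3)"
    by (simp add: char_def)
  finally show ?thesis by (simp add: algebra_simps)
qed

lemma cantor_step_fixed_point_unique:
  assumes M: "prob_space M" "sets M = sets borel" "cantor_step M = M"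
    and N: "prob_space N" "sets N = sets borel" "cantor_step N = N"
  shows "M = N"
proof -
  interpret M: real_distribution M
    using M by (auto simp: real_distribution_def real_distribution_axioms_def)
  interpret N: real_distribution N
    using N by (auto simp: real_distribution_def real_distribution_axioms_def)
  let ?d = "\<lambda>t. char M t - char N t"
  have step: "norm (?d t) \<le> norm (?d (t / 3))" for t
  proof -
    have "?d t = (1 + iexp (2 * t / 3)) / 2 * ?d (t / 3)"
      using char_cantor_step[OF M(1,2), of t] char_cantor_step[OF N(1,2), of t]
      unfolding M(3) N(3) by (simp add: algebra_simps)
    then have "norm (?d t) = norm ((1 + iexp (2 * t / 3)) / 2) * norm (?d (t / 3))"
      by (simp only: norm_mult)
    moreover have "norm ((1 + iexp (2 * t / 3)) / 2) \<le> 1"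
      using norm_triangle_ineq[of 1 "iexp (2 * t / 3)"]
      by (simp add: norm_divide)
    ultimately show ?thesis
      by (simp only:) (intro mult_left_le_one_le norm_ge_zero)
  qed
  have iter: "norm (?d t) \<le> norm (?d (t / 3 ^ n))" for t n
  proof (induction n)
    case (Suc n)
    then show ?case using step[of "t / 3 ^ n"] by (simp add: field_simps)
  qed simp
  have "char M t = char N t" for t
  proof -
    have "(\<lambda>n. t * (1 / 3) ^ n) \<longlonglongrightarrow> t * 0"
      by (intro tendsto_mult tendsto_const LIMSEQ_power_zero) auto
    then have "(\<lambda>n. t / 3 ^ n) \<longlonglongrightarrow> 0" by (simp add: power_divide)
    moreover have "isCont (\<lambda>t. norm (?d t)) 0"
      by (intro continuous_intros M.isCont_char N.isCont_char)
    ultimately have "(\<lambda>n. norm (?d (t / 3 ^ n))) \<longlonglongrightarrow> norm (?d 0)"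
      by (rule isCont_tendsto_compose[rotated])
    then have "norm (?d t) \<le> norm (?d 0)"
      by (rule LIMSEQ_le_const) (use iter in blast)
    then show ?thesis by (simp add: M.char_zero N.char_zero)
  qed
  then show ?thesis
    by (intro Levy_uniqueness M.real_distribution_axioms N.real_distribution_axioms) auto
qed

theorem cantor_self_similar_iff: "cantor_self_similar M \<longleftrightarrow> M = cantor_measure"
  unfolding cantor_self_similar_iff_step
  using cantor_step_fixed_point_unique prob_space_cantor_measure cantor_step_cantor_measure
  by auto

section \<open>Fourier frames\<close>

text \<open>Elements of \<open>L\<^sup>2(M)\<close> are represented by square-integrable functions. All quantities below
  depend only on the class of a function modulo null sets.\<close>

definition L2_functions :: "real measure \<Rightarrow> (real \<Rightarrow> complex) set" where
  "L2_functions M = {f \<in> borel_measurable M. integrable M (\<lambda>x. (cmod (f x))\<^sup>2)}"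

definition L2_inner :: "real measure \<Rightarrow> (real \<Rightarrow> complex) \<Rightarrow> (real \<Rightarrow> complex) \<Rightarrow> complex" where
  "L2_inner M f g = (LINT x|M. f x * cnj (g x))"

definition L2_norm :: "real measure \<Rightarrow> (real \<Rightarrow> complex) \<Rightarrow> real" where
  "L2_norm M f = sqrt (LINT x|M. (cmod (f x))\<^sup>2)"

definition fourier_exp :: "real \<Rightarrow> real \<Rightarrow> complex" where
  "fourier_exp \<xi> x = exp (2 * of_real pi * \<i> * of_real \<xi> * of_real x)"

text \<open>Convergence of the frame sum is required explicitly, since a divergent
  \<^const>\<open>infsum\<close> of reals would be \<open>0\<close>.\<close>

definition fourier_frame_spectrum :: "real measure \<Rightarrow> real set \<Rightarrow> bool" where
  "fourier_frame_spectrum M \<Lambda> \<longleftrightarrow>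
     countable \<Lambda> \<and>
     (\<exists>A C :: real. 0 < A \<and> A \<le> C \<and>
       (\<forall>f \<in> L2_functions M.
          (\<lambda>\<xi>. (cmod (L2_inner M f (fourier_exp \<xi>)))\<^sup>2) summable_on \<Lambda> \<and>
          A * (L2_norm M f)\<^sup>2 \<le> (\<Sum>\<^sub>\<infinity>\<xi>\<in>\<Lambda>. (cmod (L2_inner M f (fourier_exp \<xi>)))\<^sup>2) \<and>
          (\<Sum>\<^sub>\<infinity>\<xi>\<in>\<Lambda>. (cmod (L2_inner M f (fourier_exp \<xi>)))\<^sup>2) \<le> C * (L2_norm M f)\<^sup>2))"

definition admits_fourier_frame :: "real measure \<Rightarrow> bool" where
  "admits_fourier_frame M \<longleftrightarrow> (\<exists>\<Lambda>. fourier_frame_spectrum M \<Lambda>)"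

end

theory Submission
  imports Defs
begin

text \<open>
  Up to a phase, the Fourier transform of the Cantor measure at frequency \<open>\<xi>\<close> is the infinite
  product over \<open>j \<ge> 1\<close> of \<open>cos (2 * pi * \<xi> / 3 ^ j)\<close>, one factor for each ternary digit.
  Multiplying the constant \<open>1\<close> by the Rademacher function of digit \<open>m\<close>, which is \<open>1\<close> or
  \<open>- 1\<close> according to whether that digit is \<open>0\<close> or \<open>2\<close>, replaces the cosine in the factor
  \<open>j = m\<close> by a sine. These functions all have norm \<open>1\<close>, so that a frame spectrum assigns to
  each of them a total Fourier energy between \<open>A\<close> and \<open>C\<close>.

  Let \<open>m\<close> tend to infinity. At a fixed frequency the sine of \<open>x = 2 * pi * \<xi> / 3 ^ m\<close> tends
  to \<open>0\<close>, so the energy of the Rademacher function escapes to frequencies at which the constant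
  \<open>1\<close> has almost no energy left. There the tangent of \<open>x\<close> must be huge, that is, \<open>x\<close> is
  close to a zero of the cosine. The factor of the previous digit is evaluated at \<open>3 * x\<close>, and
  because \<open>3\<close> is odd, \<open>3 * x\<close> is then close to a zero of the cosine as well. Flipping the
  previous digit too therefore multiplies the energy by another huge number, and the product of two
  consecutive Rademacher functions exceeds the upper frame bound.

  The resonance between \<open>x\<close> and \<open>3 * x\<close> is the inequality \<open>sin_cos_triple_ineq\<close>; the product
  formula is \<open>fourier_power_two_digits\<close>. The inequality bounds the energy of the Rademacher function
  at each frequency by a large multiple \<open>K\<close> of the energy of \<open>1\<close> plus a small multiple
  \<open>25 / K\<close> of the energy of the product. Off a large finite set of frequencies the first term
  sums to little because the energy of \<open>1\<close> is summable, and the second because the total energy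
  of the product is at most \<open>C\<close>; on the finite set the energy of the Rademacher function vanishes
  in the limit. This contradicts the lower bound \<open>A\<close>.
\<close>

section \<open>Sign changes of digits\<close>

lemma integral_cantor_measure:
  fixes h :: "real \<Rightarrow> complex"
  assumes [measurable]: "h \<in> borel_measurable borel" and bound: "\<And>x. norm (h x) \<le> B"
  shows "(LINT x|cantor_measure. h x) =
    ((LINT x|cantor_measure. h (x / 3)) + (LINT x|cantor_measure. h ((x + 2) / 3))) / 2"
proof -
  interpret prob_space cantor_measure by (rule prob_space_cantor_measure)
  interpret coin: prob_space fair_coin by (rule measure_pmf.prob_space_axioms)
  interpret pair_prob_space fair_coin cantor_measure ..
  note [measurable_cong] = sets_cantor_measure
  note measurable_cantor_step_map[OF sets_cantor_measure, measurable]
  let ?f = "\<lambda>s x. h ((x + 2 * of_bool s) / 3)"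
  have "(LINT x|cantor_measure. h x) = (LINT x|cantor_step cantor_measure. h x)"
    by (simp only: cantor_step_cantor_measure)
  also have "\<dots> = (LINT p|(fair_coin \<Otimes>\<^sub>M cantor_measure). ?f (fst p) (snd p))"
    unfolding cantor_step_def by (subst integral_distr) (simp_all add: case_prod_beta)
  also have "\<dots> = (LINT s|fair_coin. LINT x|cantor_measure. ?f s x)"
    by (subst integral_fst'[symmetric])
       (auto intro!: P.integrable_const_bound[where B = B] bound)
  also have "\<dots> = ((LINT x|cantor_measure. ?f False x) + (LINT x|cantor_measure. ?f True x)) / 2"
    by (subst integral_measure_pmf[of UNIV])
       (auto simp: UNIV_bool scaleR_conv_of_real field_simps)
  finally show ?thesis by simp
qed

definition fourier_power :: "(real \<Rightarrow> complex) \<Rightarrow> real \<Rightarrow> real" where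
  "fourier_power g \<xi> = (cmod (L2_inner cantor_measure g (fourier_exp \<xi>)))\<^sup>2"

text \<open>On the Cantor set, the value at a point is that of \<open>g\<close> at the point with the leading
  ternary digit removed, multiplied by \<open>w\<close> if that digit is \<open>2\<close>. The cut at \<open>1 / 2\<close> lies
  in the middle gap of the Cantor set, so any other cut inside the gap would give the same element
  of \<open>L\<^sup>2\<close>.\<close>

definition glue :: "complex \<Rightarrow> (real \<Rightarrow> complex) \<Rightarrow> real \<Rightarrow> complex" where
  "glue w g x = (if x < 1 / 2 then g (3 * x) else w * g (3 * x - 2))"

text \<open>These functions have norm \<open>1\<close> in \<open>L\<^sup>2\<close> of every probability measure on the Borel
  sets, which turns the two frame inequalities into absolute bounds.\<close>

definition unimodular :: "(real \<Rightarrow> complex) \<Rightarrow> bool" where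
  "unimodular g \<longleftrightarrow> g \<in> borel_measurable borel \<and> (\<forall>x. norm (g x) = 1)"

lemma unimodular_one: "unimodular (\<lambda>_. 1)"
  by (simp add: unimodular_def)

lemma unimodular_glue:
  assumes "unimodular g" "norm w = 1"
  shows "unimodular (glue w g)"
proof -
  have [measurable]: "g \<in> borel_measurable borel" using assms by (simp add: unimodular_def)
  have "glue w g \<in> borel_measurable borel"
    unfolding glue_def[abs_def] by measurable
  then show ?thesis using assms by (simp add: unimodular_def glue_def norm_mult)
qed

lemma unimodular_glue_one_iterate: "unimodular g \<Longrightarrow> unimodular ((glue 1 ^^ n) g)"
  by (induction n) (auto intro: unimodular_glue)

section \<open>Fourier coefficients\<close>

text \<open>Both halves of the Cantor set carry a copy of \<open>g\<close>. Passing from the left copy to the right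
  one multiplies the integrand by \<open>w\<close> and by the conjugate character at \<open>2 / 3\<close>.\<close>

lemma L2_inner_glue:
  assumes g: "unimodular g" and w: "norm w = 1"
  shows "L2_inner cantor_measure (glue w g) (fourier_exp \<xi>) =
    (1 + w * cis (- 2 * (2 * pi * \<xi> / 3))) / 2 * L2_inner cantor_measure g (fourier_exp (\<xi> / 3))"
proof -
  have [measurable]: "g \<in> borel_measurable borel" "glue w g \<in> borel_measurable borel"
    using g unimodular_glue[OF g w] by (simp_all add: unimodular_def)
  have [measurable]: "fourier_exp t \<in> borel_measurable borel" for t
    unfolding fourier_exp_def[abs_def] by measurable
  have [measurable]: "cnj \<in> borel_measurable borel"
    by (intro borel_measurable_continuous_onI continuous_intros)
  note [measurable_cong] = sets_cantor_measure
  have e1: "norm (fourier_exp t x) = 1" for t x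
    by (simp add: fourier_exp_def)
  let ?h = "\<lambda>x. glue w g x * cnj (fourier_exp \<xi> x)"
  let ?k = "\<lambda>x. g x * cnj (fourier_exp (\<xi> / 3) x)"
  let ?z = "w * cis (- 2 * (2 * pi * \<xi> / 3))"
  have shift: "cnj (fourier_exp \<xi> ((x + 2) / 3)) =
      cis (- 2 * (2 * pi * \<xi> / 3)) * cnj (fourier_exp (\<xi> / 3) x)" for x
    by (simp add: fourier_exp_def exp_cnj cis_conv_exp field_simps flip: exp_add)
  have dilate: "fourier_exp \<xi> (x / 3) = fourier_exp (\<xi> / 3) x" for x
    by (simp add: fourier_exp_def)
  have glue_right: "glue w g ((x + 2) / 3) = w * g x" if "x \<in> {0..1}" for x
  proof -
    have "3 * ((x + 2) / 3) - 2 = x" by (simp add: field_simps)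
    then show ?thesis using that by (simp only: glue_def) auto
  qed
  have "(LINT x|cantor_measure. ?h (x / 3)) = (LINT x|cantor_measure. ?k x)"
  proof (rule integral_cong_AE)
    show "AE x in cantor_measure. ?h (x / 3) = ?k x"
      using AE_cantor_measure_unit_interval by eventually_elim (simp add: glue_def dilate)
  qed measurable
  moreover have "(LINT x|cantor_measure. ?h ((x + 2) / 3)) = (LINT x|cantor_measure. ?z * ?k x)"
  proof (rule integral_cong_AE)
    show "AE x in cantor_measure. ?h ((x + 2) / 3) = ?z * ?k x"
      using AE_cantor_measure_unit_interval by eventually_elim (simp add: glue_right shift)
  qed measurable
  moreover have "(LINT x|cantor_measure. ?z * ?k x) = ?z * (LINT x|cantor_measure. ?k x)"
    by simp
  moreover have "(LINT x|cantor_measure. ?h x) =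
      ((LINT x|cantor_measure. ?h (x / 3)) + (LINT x|cantor_measure. ?h ((x + 2) / 3))) / 2"
    by (rule integral_cantor_measure[where B = 1])
       (use unimodular_glue[OF g w] in \<open>auto simp: norm_mult e1 unimodular_def\<close>)
  ultimately show ?thesis
    unfolding L2_inner_def by (simp only:) (simp add: algebra_simps)
qed

lemma cmod_one_plus_cis: "(cmod ((1 + cis (- 2 * y)) / 2))\<^sup>2 = (cos y)\<^sup>2"
proof -
  have "(cmod ((1 + cis (- 2 * y)) / 2))\<^sup>2 = ((1 + cos (2 * y))\<^sup>2 + (sin (2 * y))\<^sup>2) / 4"
    by (simp add: cmod_power2 power_divide norm_divide)
  also have "\<dots> = (1 + cos (2 * y)) / 2"
    unfolding sin_squared_eq by (simp add: power2_eq_square field_simps)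
  finally show ?thesis by (simp add: cos_double_cos)
qed

lemma cmod_one_minus_cis: "(cmod ((1 - cis (- 2 * y)) / 2))\<^sup>2 = (sin y)\<^sup>2"
proof -
  have "(cmod ((1 - cis (- 2 * y)) / 2))\<^sup>2 = ((1 - cos (2 * y))\<^sup>2 + (sin (2 * y))\<^sup>2) / 4"
    by (simp add: cmod_power2 power_divide norm_divide)
  also have "\<dots> = (1 - cos (2 * y)) / 2"
    unfolding sin_squared_eq by (simp add: power2_eq_square field_simps)
  finally show ?thesis by (simp add: cos_double_sin)
qed

lemma fourier_power_glue_plus:
  assumes "unimodular g"
  shows "fourier_power (glue 1 g) \<xi> = (cos (2 * pi * \<xi> / 3))\<^sup>2 * fourier_power g (\<xi> / 3)"
  using L2_inner_glue[OF assms, of 1 \<xi>] cmod_one_plus_cis[of "2 * pi * \<xi> / 3"]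
  unfolding fourier_power_def by (simp only: norm_mult power_mult_distrib mult_1 norm_one)

lemma fourier_power_glue_minus:
  assumes "unimodular g"
  shows "fourier_power (glue (- 1) g) \<xi> = (sin (2 * pi * \<xi> / 3))\<^sup>2 * fourier_power g (\<xi> / 3)"
  using L2_inner_glue[OF assms, of "- 1" \<xi>] cmod_one_minus_cis[of "2 * pi * \<xi> / 3"]
  unfolding fourier_power_def
  by (simp only: norm_mult power_mult_distrib mult_minus1 norm_minus_cancel norm_one
      diff_conv_add_uminus)

lemma fourier_power_glue_one_iterate:
  assumes "unimodular g"
  shows "fourier_power ((glue 1 ^^ n) g) \<xi> =
    (\<Prod>j<n. (cos (2 * pi * \<xi> / 3 ^ Suc j))\<^sup>2) * fourier_power g (\<xi> / 3 ^ n)"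
proof (induction n arbitrary: \<xi>)
  case (Suc n)
  show ?case
    using fourier_power_glue_plus[OF unimodular_glue_one_iterate[OF assms, of n], of \<xi>]
      Suc.IH[of "\<xi> / 3"]
    by (simp add: prod.lessThan_Suc_shift mult.assoc del: prod.lessThan_Suc)
qed simp

lemma fourier_power_nonneg: "fourier_power g \<xi> \<ge> 0"
  by (simp add: fourier_power_def)

lemma fourier_power_le_one:
  assumes "unimodular g"
  shows "fourier_power g \<xi> \<le> 1"
proof -
  interpret prob_space cantor_measure by (rule prob_space_cantor_measure)
  have "norm (L2_inner cantor_measure g (fourier_exp \<xi>)) \<le>
      (LINT x|cantor_measure. norm (g x * cnj (fourier_exp \<xi> x)))"
    unfolding L2_inner_def by (rule integral_norm_bound)
  also have "\<dots> = 1"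
    using assms prob_space by (simp add: norm_mult unimodular_def fourier_exp_def)
  finally show ?thesis by (simp add: fourier_power_def power_le_one)
qed

lemma glue_one_const: "glue 1 (\<lambda>_. c) = (\<lambda>_. c)"
  by (simp add: glue_def fun_eq_iff)

text \<open>The number \<open>n\<close> counts the digits in front of the first flipped one. Hence
  \<open>rademacher_pair n\<close> agrees on the Cantor set with the product of \<open>rademacher n\<close> and
  \<open>rademacher (Suc n)\<close>.\<close>

abbreviation rademacher :: "nat \<Rightarrow> real \<Rightarrow> complex" where
  "rademacher n \<equiv> (glue 1 ^^ n) (glue (- 1) (\<lambda>_. 1))"

abbreviation rademacher_pair :: "nat \<Rightarrow> real \<Rightarrow> complex" where
  "rademacher_pair n \<equiv> (glue 1 ^^ n) (glue (- 1) (glue (- 1) (\<lambda>_. 1)))"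

text \<open>Flipping the sign of a digit turns its factor from a squared cosine into a squared sine, and
  the digits outside the pair contribute the same factor \<open>Q\<close> to all three functions. The two
  digits see the angles \<open>3 * x\<close> and \<open>x\<close>, since consecutive factors are related by the
  contraction ratio \<open>1 / 3\<close> of the measure.\<close>

lemma fourier_power_two_digits:
  fixes n \<xi>
  defines "x \<equiv> 2 * pi * \<xi> / 3 ^ (n + 2)"
  obtains Q where "0 \<le> Q" "Q \<le> 1"
    "fourier_power (\<lambda>_. 1) \<xi> = Q * ((cos x)\<^sup>2 * (cos (3 * x))\<^sup>2)"
    "fourier_power (rademacher (Suc n)) \<xi> = Q * ((sin x)\<^sup>2 * (cos (3 * x))\<^sup>2)"
    "fourier_power (rademacher_pair n) \<xi> = Q * ((sin x)\<^sup>2 * (sin (3 * x))\<^sup>2)"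
proof
  let ?P = "\<Prod>j<n. (cos (2 * pi * \<xi> / 3 ^ Suc j))\<^sup>2"
  let ?Q = "?P * fourier_power (\<lambda>_. 1) (\<xi> / 3 ^ (n + 2))"
  note u = unimodular_one unimodular_glue[OF unimodular_one]
  have x3: "2 * pi * (\<xi> / 3 ^ n) / 3 = 3 * x" "2 * pi * (\<xi> / 3 ^ n / 3) / 3 = x"
    "\<xi> / 3 ^ n / 3 / 3 = \<xi> / 3 ^ (n + 2)"
    by (simp_all add: x_def)
  have P: "0 \<le> ?P" "?P \<le> 1"
    by (auto intro!: prod_nonneg prod_le_1 simp: abs_square_le_1)
  show "0 \<le> ?Q" using P fourier_power_nonneg by simp
  show "?Q \<le> 1" using P fourier_power_nonneg fourier_power_le_one[OF unimodular_one]
    by (intro mult_le_one) auto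
  have const: "(glue 1 ^^ n) (glue 1 (glue 1 (\<lambda>_. 1))) = (\<lambda>_. 1)"
    by (induction n) (simp_all add: glue_one_const)
  have "fourier_power ((glue 1 ^^ n) (glue 1 (glue 1 (\<lambda>_. 1)))) \<xi> =
      ?Q * ((cos x)\<^sup>2 * (cos (3 * x))\<^sup>2)"
    by (simp only: fourier_power_glue_one_iterate fourier_power_glue_plus u unimodular_glue
        norm_one x3) (simp only: ac_simps)
  then show "fourier_power (\<lambda>_. 1) \<xi> = ?Q * ((cos x)\<^sup>2 * (cos (3 * x))\<^sup>2)"
    by (simp only: const)
  show "fourier_power (rademacher (Suc n)) \<xi> = ?Q * ((sin x)\<^sup>2 * (cos (3 * x))\<^sup>2)"
    by (simp only: funpow_Suc_right o_apply fourier_power_glue_one_iterate fourier_power_glue_plus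
        fourier_power_glue_minus u unimodular_glue norm_one norm_minus_cancel x3)
       (simp only: ac_simps)
  show "fourier_power (rademacher_pair n) \<xi> = ?Q * ((sin x)\<^sup>2 * (sin (3 * x))\<^sup>2)"
    by (simp only: fourier_power_glue_one_iterate fourier_power_glue_minus u unimodular_glue
        norm_one norm_minus_cancel x3) (simp only: ac_simps)
qed

section \<open>Resonance of consecutive digits\<close>

text \<open>If the tangent of \<open>x\<close> is small, the first term on the right suffices. If it is large,
  \<open>cos x\<close> is small, and since \<open>cos x\<close> divides \<open>cos (3 * x)\<close> in the triple angle formula,
  \<open>cos (3 * x)\<close> is small in comparison with \<open>sin (3 * x)\<close> and the second term suffices. For an
  even multiple of \<open>x\<close> this fails: \<open>cos (4 * x)\<close> is \<open>1\<close> where \<open>cos x\<close> vanishes.\<close>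

lemma sin_cos_triple_ineq:
  fixes x K :: real
  assumes K: "K \<ge> 9"
  shows "(sin x)\<^sup>2 * (cos (3 * x))\<^sup>2 \<le>
    K * ((cos x)\<^sup>2 * (cos (3 * x))\<^sup>2) + 25 / K * ((sin x)\<^sup>2 * (sin (3 * x))\<^sup>2)"
proof (cases "(sin x)\<^sup>2 \<le> K * (cos x)\<^sup>2")
  case True
  then have "(sin x)\<^sup>2 * (cos (3 * x))\<^sup>2 \<le> K * (cos x)\<^sup>2 * (cos (3 * x))\<^sup>2"
    by (rule mult_right_mono) simp
  moreover have "0 \<le> 25 / K * ((sin x)\<^sup>2 * (sin (3 * x))\<^sup>2)" using K by simp
  ultimately show ?thesis by (simp add: mult.assoc)
next
  case False
  define a where "a = (cos x)\<^sup>2"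
  have s: "(sin x)\<^sup>2 = 1 - a" by (simp add: a_def sin_squared_eq)
  have a: "0 \<le> a" by (simp add: a_def)
  have aK: "K * a < 1 - a" using False by (simp add: a_def s)
  moreover have "9 * a \<le> K * a" using K a by (intro mult_right_mono)
  ultimately have a10: "a \<le> 1 / 10" by simp
  have c3: "(cos (3 * x))\<^sup>2 = a * (3 - 4 * a)\<^sup>2"
  proof -
    have "cos (3 * x) = - (cos x * (3 - 4 * a))"
      unfolding cos_treble_cos
      by (simp add: a_def power2_eq_square power3_eq_cube algebra_simps)
    then show ?thesis by (simp add: a_def power_mult_distrib)
  qed
  have s3: "(sin (3 * x))\<^sup>2 = (1 - a) * (1 - 4 * a)\<^sup>2"
    unfolding sin_squared_eq c3 by (simp add: power2_eq_square algebra_simps)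
  \<comment> \<open>The bound on \<open>a\<close> keeps \<open>sin (3 * x)\<close> away from \<open>0\<close>; this is where \<open>K\<close> must not be
    too small.\<close>
  have "(3 - 4 * a)\<^sup>2 \<le> 3\<^sup>2" using a a10 by (intro power_mono) auto
  moreover have "(3 / 5)\<^sup>2 \<le> (1 - 4 * a)\<^sup>2" using a a10 by (intro power_mono) auto
  ultimately have "(3 - 4 * a)\<^sup>2 \<le> 25 * (1 - 4 * a)\<^sup>2" by (simp add: power2_eq_square)
  then have "K * a * (3 - 4 * a)\<^sup>2 \<le> (1 - a) * (25 * (1 - 4 * a)\<^sup>2)"
    using aK a a10 by (intro mult_mono) auto
  then have "(cos (3 * x))\<^sup>2 \<le> 25 / K * (sin (3 * x))\<^sup>2"
    unfolding c3 s3 using K by (simp add: field_simps)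
  then have "(sin x)\<^sup>2 * (cos (3 * x))\<^sup>2 \<le> (sin x)\<^sup>2 * (25 / K * (sin (3 * x))\<^sup>2)"
    by (rule mult_left_mono) simp
  moreover have "0 \<le> K * ((cos x)\<^sup>2 * (cos (3 * x))\<^sup>2)" using K by simp
  ultimately show ?thesis by (simp add: algebra_simps)
qed

text \<open>Summed over a frame spectrum, the last term is at most \<open>25 / K\<close> times the upper frame bound,
  whatever \<open>n\<close> is.\<close>

lemma fourier_power_rademacher_le:
  assumes "K \<ge> 9"
  shows "fourier_power (rademacher (Suc n)) \<xi> \<le>
    K * fourier_power (\<lambda>_. 1) \<xi> + 25 / K * fourier_power (rademacher_pair n) \<xi>"
proof -
  define x where "x = 2 * pi * \<xi> / 3 ^ (n + 2)"
  obtain Q where Q: "0 \<le> Q"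
    "fourier_power (\<lambda>_. 1) \<xi> = Q * ((cos x)\<^sup>2 * (cos (3 * x))\<^sup>2)"
    "fourier_power (rademacher (Suc n)) \<xi> = Q * ((sin x)\<^sup>2 * (cos (3 * x))\<^sup>2)"
    "fourier_power (rademacher_pair n) \<xi> = Q * ((sin x)\<^sup>2 * (sin (3 * x))\<^sup>2)"
    unfolding x_def by (rule fourier_power_two_digits)
  show ?thesis
    using mult_left_mono[OF sin_cos_triple_ineq[OF assms, of x] Q(1)]
    unfolding Q(2-4) by (simp add: algebra_simps)
qed

lemma fourier_power_rademacher_tendsto_0:
  "(\<lambda>n. fourier_power (rademacher (Suc n)) \<xi>) \<longlonglongrightarrow> 0"
proof (rule tendsto_sandwich[where f = "\<lambda>_. 0"])
  let ?x = "\<lambda>n. 2 * pi * \<xi> / 3 ^ (n + 2) :: real"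
  have "(\<lambda>n. 2 * pi * \<xi> / 9 * (1 / 3) ^ n) \<longlonglongrightarrow> 2 * pi * \<xi> / 9 * 0"
    by (intro tendsto_mult tendsto_const LIMSEQ_power_zero) auto
  then have "?x \<longlonglongrightarrow> 0" by (simp add: power_divide)
  then have "(\<lambda>n. (sin (?x n))\<^sup>2) \<longlonglongrightarrow> (sin 0)\<^sup>2" by (intro tendsto_intros)
  then show "(\<lambda>n. (sin (?x n))\<^sup>2) \<longlonglongrightarrow> 0" by simp
  show "\<forall>\<^sub>F n in sequentially. fourier_power (rademacher (Suc n)) \<xi> \<le> (sin (?x n))\<^sup>2"
  proof (rule always_eventually, rule allI)
    fix n
    obtain Q where Q: "0 \<le> Q" "Q \<le> 1"
      "fourier_power (rademacher (Suc n)) \<xi> = Q * ((sin (?x n))\<^sup>2 * (cos (3 * ?x n))\<^sup>2)"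
      by (rule fourier_power_two_digits)
    have "(cos (3 * ?x n))\<^sup>2 \<le> 1" by (simp add: abs_square_le_1)
    then have "Q * ((sin (?x n))\<^sup>2 * (cos (3 * ?x n))\<^sup>2) \<le> 1 * ((sin (?x n))\<^sup>2 * 1)"
      using Q by (intro mult_mono) auto
    then show "fourier_power (rademacher (Suc n)) \<xi> \<le> (sin (?x n))\<^sup>2"
      unfolding Q(3) by simp
  qed
qed (auto intro: always_eventually simp: fourier_power_nonneg)

section \<open>Contradiction to the frame inequalities\<close>

lemma fourier_frame_unimodular:
  assumes "fourier_frame_spectrum cantor_measure \<Lambda>"
  obtains A C where "0 < A" "A \<le> C"
    "\<And>g. unimodular g \<Longrightarrow> fourier_power g summable_on \<Lambda>"
    "\<And>g. unimodular g \<Longrightarrow> A \<le> infsum (fourier_power g) \<Lambda>"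
    "\<And>g. unimodular g \<Longrightarrow> infsum (fourier_power g) \<Lambda> \<le> C"
proof -
  interpret prob_space cantor_measure by (rule prob_space_cantor_measure)
  note [measurable_cong] = sets_cantor_measure
  have L2: "g \<in> L2_functions cantor_measure" "L2_norm cantor_measure g = 1"
    if "unimodular g" for g
  proof -
    have [measurable]: "g \<in> borel_measurable borel" using that by (simp add: unimodular_def)
    have "g \<in> borel_measurable cantor_measure" by measurable
    then show "g \<in> L2_functions cantor_measure" "L2_norm cantor_measure g = 1"
      using that prob_space by (simp_all add: unimodular_def L2_functions_def L2_norm_def)
  qed
  have power: "fourier_power g = (\<lambda>\<xi>. (cmod (L2_inner cantor_measure g (fourier_exp \<xi>)))\<^sup>2)" for g
    by (simp add: fourier_power_def fun_eq_iff)
  from assms obtain A C where AC: "0 < A" "A \<le> C"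
    and f: "\<forall>f \<in> L2_functions cantor_measure. fourier_power f summable_on \<Lambda> \<and>
       A * (L2_norm cantor_measure f)\<^sup>2 \<le> infsum (fourier_power f) \<Lambda> \<and>
       infsum (fourier_power f) \<Lambda> \<le> C * (L2_norm cantor_measure f)\<^sup>2"
    unfolding fourier_frame_spectrum_def power by auto
  show thesis
    by (rule that[OF AC]) (use f L2 in force)+
qed

lemma summable_on_small_tail:
  fixes u :: "'a \<Rightarrow> real"
  assumes "u summable_on S" "e > 0"
  obtains F where "finite F" "F \<subseteq> S" "infsum u (S - F) < e"
proof -
  obtain F where F: "finite F" "F \<subseteq> S" "dist (sum u F) (infsum u S) < e"
    using has_sum_infsum[OF assms(1)] assms(2)
    by (force simp: has_sum_def tendsto_iff eventually_finite_subsets_at_top)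
  have "infsum u (S - F) = infsum u S - infsum u F"
    using assms(1) F by (intro infsum_Diff) auto
  then show thesis using F by (intro that[of F]) (auto simp: dist_real_def)
qed

text \<open>The finite set \<open>F\<close> is chosen through the energy of the constant \<open>1\<close> alone, so that the
  digit can be chosen after it, far beyond the scale of all frequencies in \<open>F\<close>.\<close>

theorem corollary1p3:
  shows "\<not> admits_fourier_frame cantor_measure"
proof
  assume "admits_fourier_frame cantor_measure"
  then obtain \<Lambda> where "fourier_frame_spectrum cantor_measure \<Lambda>"
    by (auto simp: admits_fourier_frame_def)
  then obtain A C where AC: "0 < A" "A \<le> C"
    and summable: "\<And>g. unimodular g \<Longrightarrow> fourier_power g summable_on \<Lambda>"
    and lower: "\<And>g. unimodular g \<Longrightarrow> A \<le> infsum (fourier_power g) \<Lambda>"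
    and upper: "\<And>g. unimodular g \<Longrightarrow> infsum (fourier_power g) \<Lambda> \<le> C"
    by (rule fourier_frame_unimodular) blast
  let ?r = "\<lambda>n. rademacher (Suc n)"
  let ?g = rademacher_pair
  have r: "unimodular (?r n)" and g: "unimodular (?g n)" for n
    by (intro unimodular_glue_one_iterate unimodular_glue unimodular_one; simp)+
  \<comment> \<open>The three estimates below are each to cost \<open>A / 3\<close>; for the one with the upper frame bound
    this means \<open>25 / K * C = A / 3\<close>.\<close>
  define K where "K = 75 * C / A"
  have K: "K \<ge> 9" using AC by (simp add: K_def field_simps)
  obtain F where F: "finite F" "F \<subseteq> \<Lambda>" "infsum (fourier_power (\<lambda>_. 1)) (\<Lambda> - F) < A / (3 * K)"
    using summable_on_small_tail[OF summable[OF unimodular_one], of "A / (3 * K)"] AC K by auto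
  have "(\<lambda>n. \<Sum>\<xi>\<in>F. fourier_power (?r n) \<xi>) \<longlonglongrightarrow> (\<Sum>\<xi>\<in>F. 0)"
    by (intro tendsto_sum fourier_power_rademacher_tendsto_0)
  then have "\<forall>\<^sub>F n in sequentially. (\<Sum>\<xi>\<in>F. fourier_power (?r n) \<xi>) < A / 3"
    using AC by (intro order_tendstoD(2)[where y = "\<Sum>\<xi>\<in>F. 0"]) auto
  then obtain n where n: "(\<Sum>\<xi>\<in>F. fourier_power (?r n) \<xi>) < A / 3"
    by (auto simp: eventually_sequentially)
  have sub: "fourier_power h summable_on (\<Lambda> - F)" if "unimodular h" for h
    using summable[OF that] by (rule summable_on_subset_banach) auto
  have "infsum (fourier_power (?r n)) (\<Lambda> - F) \<le>
      infsum (\<lambda>\<xi>. K * fourier_power (\<lambda>_. 1) \<xi> + 25 / K * fourier_power (?g n) \<xi>) (\<Lambda> - F)"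
    by (intro infsum_mono fourier_power_rademacher_le[OF K] sub[OF r] summable_on_add
        summable_on_cmult_right sub[OF unimodular_one] sub[OF g])
  also have "\<dots> = K * infsum (fourier_power (\<lambda>_. 1)) (\<Lambda> - F) +
      25 / K * infsum (fourier_power (?g n)) (\<Lambda> - F)"
    by (simp only: infsum_add summable_on_cmult_right sub unimodular_one g infsum_cmult_right')
  also have "\<dots> < K * (A / (3 * K)) + 25 / K * C"
  proof (rule add_less_le_mono)
    show "K * infsum (fourier_power (\<lambda>_. 1)) (\<Lambda> - F) < K * (A / (3 * K))"
      using F(3) K by (intro mult_strict_left_mono) auto
    have "infsum (fourier_power (?g n)) (\<Lambda> - F) \<le> infsum (fourier_power (?g n)) \<Lambda>"
      by (intro infsum_mono2 sub summable g) (auto simp: fourier_power_nonneg)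
    then show "25 / K * infsum (fourier_power (?g n)) (\<Lambda> - F) \<le> 25 / K * C"
      using upper[OF g, of n] K by (intro mult_left_mono) auto
  qed
  also have "\<dots> = 2 * A / 3" using AC K by (simp add: K_def field_simps)
  finally have tail: "infsum (fourier_power (?r n)) (\<Lambda> - F) < 2 * A / 3" .
  have "infsum (fourier_power (?r n)) (\<Lambda> - F) =
      infsum (fourier_power (?r n)) \<Lambda> - infsum (fourier_power (?r n)) F"
    using F by (intro infsum_Diff summable r) auto
  then show False using tail n lower[OF r, of n] F(1) by simp
qed

end
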